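(* Suppose that $X$ has no isolated point. Let $(X,f_{1,\infty})$ be a non-autonomous discrete system with $f_{1,\infty}$ feeble open and surjective and converging uniformly to a map $f$. If $\{f_n^{n+k}\}_{k\in\mathbb{N}}$ converges collectively to $\{f^k\}_{k\in\mathbb{N}}$, then $(X,f)$ is transitive if and only if $(X,f_{1,\infty})$ is transitive.
   Context: $\mathbb{N}=\{1,2,3,\dots\}$. A non-autonomous discrete system $(X,f_{1,\infty})$ consists of a compact metric space $(X,d)$ and a sequence $f_{1,\infty}=\{f_n\}_{n=1}^\infty$ of continuous maps $f_n:X\to X$. For $i,n\in\mathbb{N}$, $f_i^n:=f_{i+(n-1)}\circ\cdots\circ f_i$ (a composition of $n$ maps), and $f_i^0=id_X$. The autonomous system $(X,f)$ is the special case $f_n=f$ for all $n$. Uniform convergence of $f_{1,\infty}$ to $f:X\to X$ means $D(f_n,f)\to 0$, where $D(g,h)=\sup_{x\in X}d(g(x),h(x))$. "$\{f_n^{n+k}\}_{k\in\mathbb{N}}$ converges collectively to $\{f^k\}_{k\in\mathbb{N}}$" means: for every $\varepsilon>0$ there exists $r_0\in\mathbb{N}$ such that $D(f_r^k,f^k)<\varepsilon$ for all $r\ge r_0$ and all $k\in\mathbb{N}$, where $f_r^k=f_{r+k-1}\circ\cdots\circ f_r$ and $f^k$ is the $k$-fold composition of $f$. $f_{1,\infty}$ is surjective if every $f_i$ is surjective. It is feeble open if $\mathrm{int}(f_i(U))\neq\emptyset$ for every nonempty open $U\subseteq X$ and every $i\in\mathbb{N}$. The system $(X,f_{1,\infty})$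 is transitive if for any two nonempty open subsets $U,V\subseteq X$ there exists $n\in\mathbb{N}$ such that $f_1^n(U)\cap V\neq\emptyset$. *)

theory Defs
  imports "HOL-Analysis.Analysis"
begin

text \<open>
  The space \<open>X\<close> is the universe of a type of class \<open>metric_space\<close>. A sequence of
  maps is indexed from 1: \<open>fs 0\<close> is junk and is never constrained or used.
\<close>

definition nonautonomous_system :: "(nat \<Rightarrow> 'a::metric_space \<Rightarrow> 'a) \<Rightarrow> bool" where
  "nonautonomous_system fs \<longleftrightarrow>
     compact (UNIV :: 'a set) \<and> (\<forall>n\<ge>1. continuous_on UNIV (fs n))"

text \<open>\<open>comp_seq fs i n\<close> is the composition of the \<open>n\<close> maps \<open>fs (i + n - 1) \<circ> \<dots> \<circ> fs i\<close>.\<close>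

primrec comp_seq :: "(nat \<Rightarrow> 'a \<Rightarrow> 'a) \<Rightarrow> nat \<Rightarrow> nat \<Rightarrow> 'a \<Rightarrow> 'a" where
  "comp_seq fs i 0 = id"
| "comp_seq fs i (Suc n) = fs (i + n) \<circ> comp_seq fs i n"

lemma comp_seq_const: "comp_seq (\<lambda>_. f) i n = f ^^ n"
  by (induction n) simp_all

text \<open>A real supremum, hence meaningful only if the distances are bounded; on a compact
  space they always are.\<close>

definition sup_dist :: "('a::metric_space \<Rightarrow> 'a) \<Rightarrow> ('a \<Rightarrow> 'a) \<Rightarrow> real" where
  "sup_dist g h = (SUP x. dist (g x) (h x))"

lemma bdd_above_sup_dist:
  fixes g h :: "'a::metric_space \<Rightarrow> 'a"
  assumes "compact (UNIV :: 'a set)"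
  shows "bdd_above (range (\<lambda>x. dist (g x) (h x)))"
proof (rule bdd_aboveI2)
  show "dist (g x) (h x) \<le> diameter (UNIV :: 'a set)" for x
    using diameter_bounded_bound[OF compact_imp_bounded[OF assms]] by blast
qed

definition converges_uniformly ::
    "(nat \<Rightarrow> 'a::metric_space \<Rightarrow> 'a) \<Rightarrow> ('a \<Rightarrow> 'a) \<Rightarrow> bool" where
  "converges_uniformly fs f \<longleftrightarrow> (\<lambda>n. sup_dist (fs n) f) \<longlonglongrightarrow> 0"

definition converges_collectively ::
    "(nat \<Rightarrow> 'a::metric_space \<Rightarrow> 'a) \<Rightarrow> ('a \<Rightarrow> 'a) \<Rightarrow> bool" where
  "converges_collectively fs f \<longleftrightarrow>
     (\<forall>\<epsilon>>0. \<exists>r0\<ge>1. \<forall>r\<ge>r0. \<forall>k\<ge>1. sup_dist (comp_seq fs r k) (f ^^ k) < \<epsilon>)"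

definition surjective_system :: "(nat \<Rightarrow> 'a \<Rightarrow> 'a) \<Rightarrow> bool" where
  "surjective_system fs \<longleftrightarrow> (\<forall>i\<ge>1. surj (fs i))"

definition feeble_open :: "(nat \<Rightarrow> 'a::topological_space \<Rightarrow> 'a) \<Rightarrow> bool" where
  "feeble_open fs \<longleftrightarrow>
     (\<forall>i\<ge>1. \<forall>U. open U \<and> U \<noteq> {} \<longrightarrow> interior (fs i ` U) \<noteq> {})"

definition transitive_system :: "(nat \<Rightarrow> 'a::topological_space \<Rightarrow> 'a) \<Rightarrow> bool" where
  "transitive_system fs \<longleftrightarrow>
     (\<forall>U V. open U \<and> U \<noteq> {} \<and> open V \<and> V \<noteq> {} \<longrightarrow>
        (\<exists>n\<ge>1. comp_seq fs 1 n ` U \<inter> V \<noteq> {}))"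

end

theory Submission
  imports Defs
begin

text \<open>
  Collective convergence makes the tail orbit \<open>f\<^sub>r\<^sup>k y\<close> shadow \<open>f\<^sup>k y\<close> for a single \<open>r\<close> and all
  \<open>k\<close>, so only the passage through the first \<open>r - 1\<close> maps \<open>g = f\<^sub>1\<^sup>r\<^sup>-\<^sup>1\<close> needs care.
  If \<open>f\<close> is transitive, apply this to \<open>f\<close> and the interior of \<open>g(U)\<close>, which is nonempty by feeble
  openness. Conversely, surjectivity makes the preimage of \<open>U\<close> under \<open>g\<close> nonempty, and one needs a
  hitting time that is at least \<open>r\<close>: without isolated points, hitting times of a transitive
  system can be chosen arbitrarily large.
\<close>

lemma comp_seq_add: "comp_seq fs i (m + n) = comp_seq fs (i + m) n \<circ> comp_seq fs i m"
  by (induction n) (simp_all add: add.assoc comp_assoc)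

lemma continuous_on_comp_seq:
  assumes "nonautonomous_system fs" and "i \<ge> 1"
  shows "continuous_on UNIV (comp_seq fs i n)"
proof (induction n)
  case 0
  show ?case by (simp add: id_def)
next
  case (Suc n)
  have "continuous_on UNIV (fs (i + n))"
    using assms by (simp add: nonautonomous_system_def)
  with Suc show ?case
    unfolding comp_seq.simps by (meson continuous_on_compose continuous_on_subset subset_UNIV)
qed

lemma surj_comp_seq:
  assumes "surjective_system fs" and "i \<ge> 1"
  shows "surj (comp_seq fs i n)"
  using assms by (induction n) (simp_all add: surjective_system_def comp_surj del: o_apply)

text \<open>The image of \<open>U\<close> need not be open, so each step applies
  \<open>feeble_open\<close> to its interior, which is open and nonempty by induction.\<close>

lemma feeble_open_comp_seq:
  assumes "feeble_open fs" and "i \<ge> 1" and "open U" and "U \<noteq> {}"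
  shows "interior (comp_seq fs i n ` U) \<noteq> {}"
proof (induction n)
  case 0
  show ?case using assms by (simp add: interior_open)
next
  case (Suc n)
  let ?W = "interior (comp_seq fs i n ` U)"
  have "interior (fs (i + n) ` ?W) \<noteq> {}"
    using assms Suc by (simp add: feeble_open_def)
  moreover have "fs (i + n) ` ?W \<subseteq> comp_seq fs i (Suc n) ` U"
    using interior_subset by (force simp: image_comp[symmetric])
  ultimately show ?case
    using interior_mono by blast
qed

lemma dist_le_sup_dist:
  fixes g h :: "'a::metric_space \<Rightarrow> 'a"
  assumes "compact (UNIV :: 'a set)"
  shows "dist (g x) (h x) \<le> sup_dist g h"
  unfolding sup_dist_def by (rule cSUP_upper[OF UNIV_I bdd_above_sup_dist[OF assms]])

text \<open>The threshold is written \<open>1 + m\<close> so that \<open>comp_seq_add\<close> splits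
  an orbit into the first \<open>m\<close> maps and a tail close to \<open>f\<close>.\<close>

lemma converges_collectivelyE:
  assumes "nonautonomous_system fs" and "converges_collectively fs f" and "\<epsilon> > 0"
  obtains m where "\<And>k x. k \<ge> 1 \<Longrightarrow> dist (comp_seq fs (1 + m) k x) ((f ^^ k) x) < \<epsilon>"
proof -
  obtain r where r: "r \<ge> 1" "\<And>k. k \<ge> 1 \<Longrightarrow> sup_dist (comp_seq fs r k) (f ^^ k) < \<epsilon>"
    using assms(2,3) unfolding converges_collectively_def by blast
  have c: "compact (UNIV :: 'a set)"
    using assms(1) by (simp add: nonautonomous_system_def)
  show thesis
  proof (rule that[of "r - 1"])
    show "dist (comp_seq fs (1 + (r - 1)) k x) ((f ^^ k) x) < \<epsilon>" if "k \<ge> 1" for k x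
      using dist_le_sup_dist[OF c, of "comp_seq fs r k" x "f ^^ k"] r(1) r(2)[OF that] by simp
  qed
qed

text \<open>Each induction step rules out one more hitting time by passing to smaller open sets,
  hence \<open>U\<close> and \<open>V\<close> are arbitrary.\<close>

lemma transitive_system_hits_late:
  fixes fs :: "nat \<Rightarrow> 'a::metric_space \<Rightarrow> 'a"
  assumes "\<not> (\<exists>x::'a. x isolated_in UNIV)"
    and "nonautonomous_system fs" and "transitive_system fs"
    and "open U" and "U \<noteq> {}" and "open V" and "V \<noteq> {}"
  shows "\<exists>n\<ge>N. comp_seq fs 1 n ` U \<inter> V \<noteq> {}"
  using assms(4-)
proof (induction N arbitrary: U V)
  case 0
  then show ?case
    using assms(3) unfolding transitive_system_def by (meson zero_le)
next
  case (Suc N)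
  \<comment> \<open>Shrink \<open>U\<close> and \<open>V\<close> so that time \<open>N\<close> is no longer a hitting time.\<close>
  let ?g = "comp_seq fs 1 N"
  obtain x where x: "x \<in> U" using Suc.prems by blast
  \<comment> \<open>Otherwise \<open>?g x\<close> would be an isolated point.\<close>
  have "V \<noteq> {?g x}"
    using assms(1) \<open>open V\<close> by (auto simp: isolated_in_def)
  then obtain b where b: "b \<in> V" "b \<noteq> ?g x"
    using \<open>V \<noteq> {}\<close> by blast
  obtain P Q where PQ: "open P" "open Q" "b \<in> P" "?g x \<in> Q" "P \<inter> Q = {}"
    using hausdorff[OF b(2)] by blast
  let ?U = "U \<inter> ?g -` Q" and ?V = "V \<inter> P"
  have "open (?g -` Q)"
    using continuous_on_comp_seq[OF assms(2)] PQ(2) by (simp add: open_vimage)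
  then have "open ?U" "open ?V"
    using Suc.prems PQ by auto
  moreover have "?U \<noteq> {}" "?V \<noteq> {}"
    using x b PQ by auto
  ultimately obtain n where n: "n \<ge> N" "comp_seq fs 1 n ` ?U \<inter> ?V \<noteq> {}"
    using Suc.IH by meson
  \<comment> \<open>At time \<open>N\<close> all of \<open>?U\<close> lands in \<open>Q\<close>,
    which misses \<open>P\<close>.\<close>
  have "?g ` ?U \<inter> ?V = {}"
    using PQ(5) by auto
  with n have "n \<ge> Suc N"
    by (metis Suc_leI le_neq_implies_less)
  moreover have "comp_seq fs 1 n ` U \<inter> V \<noteq> {}"
    using n(2) by auto
  ultimately show ?case
    by blast
qed

theorem theorem9:
  fixes fs :: "nat \<Rightarrow> 'a::metric_space \<Rightarrow> 'a" and f :: "'a \<Rightarrow> 'a"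
  assumes "\<not> (\<exists>x::'a. x isolated_in UNIV)"
    and "nonautonomous_system fs"
    and "feeble_open fs"
    and "surjective_system fs"
    and "converges_uniformly fs f"
    and "converges_collectively fs f"
  shows "transitive_system (\<lambda>_. f) \<longleftrightarrow> transitive_system fs"
proof
  assume T: "transitive_system (\<lambda>_. f)"
  show "transitive_system fs"
    unfolding transitive_system_def
  proof (intro allI impI, elim conjE)
    fix U V :: "'a set"
    assume UV: "open U" "U \<noteq> {}" "open V" "V \<noteq> {}"
    then obtain v e where e: "e > 0" "ball v e \<subseteq> V"
      using open_contains_ball by blast
    then obtain m where m: "\<And>k x. k \<ge> 1 \<Longrightarrow> dist (comp_seq fs (1 + m) k x) ((f ^^ k) x) < e / 2"
      using converges_collectivelyE[OF assms(2,6), of "e / 2"] by auto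
    let ?W = "interior (comp_seq fs 1 m ` U)"
    have "?W \<noteq> {}"
      using feeble_open_comp_seq[OF assms(3)] UV by simp
    moreover have "ball v (e / 2) \<noteq> {}"
      using e by simp
    \<comment> \<open>Aiming at the half ball leaves \<open>e / 2\<close> for the shadowing
      error.\<close>
    ultimately obtain n where n: "n \<ge> 1" "(f ^^ n) ` ?W \<inter> ball v (e / 2) \<noteq> {}"
      using T unfolding transitive_system_def comp_seq_const by (meson open_ball open_interior)
    then obtain y where y: "y \<in> ?W" "dist v ((f ^^ n) y) < e / 2"
      by auto
    then obtain x where x: "x \<in> U" "y = comp_seq fs 1 m x"
      using interior_subset by blast
    have "dist v (comp_seq fs (1 + m) n y) < e"
      by (rule dist_triangle_half_l[OF y(2) m[OF n(1)]])
    with e x have "comp_seq fs 1 (m + n) x \<in> V"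
      unfolding comp_seq_add by auto
    with x n show "\<exists>n\<ge>1. comp_seq fs 1 n ` U \<inter> V \<noteq> {}"
      by (intro exI[of _ "m + n"]) auto
  qed
next
  assume T: "transitive_system fs"
  show "transitive_system (\<lambda>_. f)"
    unfolding transitive_system_def comp_seq_const
  proof (intro allI impI, elim conjE)
    fix U V :: "'a set"
    assume UV: "open U" "U \<noteq> {}" "open V" "V \<noteq> {}"
    then obtain v e where e: "e > 0" "ball v e \<subseteq> V"
      using open_contains_ball by blast
    then obtain m where m: "\<And>k x. k \<ge> 1 \<Longrightarrow> dist (comp_seq fs (1 + m) k x) ((f ^^ k) x) < e / 2"
      using converges_collectivelyE[OF assms(2,6), of "e / 2"] by auto
    \<comment> \<open>Points of \<open>?W\<close> are in \<open>U\<close> after \<open>m\<close>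
      steps, where the tail of their orbit begins to shadow an orbit of \<open>f\<close>.\<close>
    let ?W = "comp_seq fs 1 m -` U"
    have "open ?W"
      using continuous_on_comp_seq[OF assms(2)] UV by (simp add: open_vimage)
    moreover have "?W \<noteq> {}"
      using surj_comp_seq[OF assms(4), of 1 m] UV by (metis order_refl surj_vimage_empty)
    moreover have "ball v (e / 2) \<noteq> {}"
      using e by simp
    \<comment> \<open>The bound \<open>m + 1\<close> makes \<open>n = l - m\<close> at least 1, as
      both the shadowing estimate and transitivity require.\<close>
    ultimately obtain l where l: "l \<ge> m + 1" "comp_seq fs 1 l ` ?W \<inter> ball v (e / 2) \<noteq> {}"
      using transitive_system_hits_late[OF assms(1,2) T] open_ball by meson
    obtain n where n: "n \<ge> 1" "l = m + n"
      using l(1) that[of "l - m"] by simp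
    obtain x where x: "comp_seq fs 1 m x \<in> U" "dist v (comp_seq fs 1 l x) < e / 2"
      using l by auto
    let ?y = "comp_seq fs 1 m x"
    have "dist v (comp_seq fs (1 + m) n ?y) < e / 2"
      using x(2) unfolding n(2) comp_seq_add by simp
    then have "dist v ((f ^^ n) ?y) < e"
      using m[OF n(1), of ?y] by (auto intro: dist_triangle_half_l simp: dist_commute)
    with e(2) have "(f ^^ n) ?y \<in> V"
      by auto
    with x(1) n(1) show "\<exists>n\<ge>1. (f ^^ n) ` U \<inter> V \<noteq> {}"
      by blast
  qed
qed

end
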